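(* Let $n$ and $\ell$ be integers satisfying $n/2<\ell<n$, and let $\alpha$ be a zero-free sequence of length $\ell$ in $\mathbb{Z}_n$. a) For $n$ even, $\alpha$ contains a generator of multiplicity at least $2\ell-n+1$. This estimate is best possible. b) For $n$ odd, $\alpha$ contains a generator of multiplicity at least $2\ell-n+1$ if $(2n-2)/3\le\ell<n$, and at least $\ell-\lfloor (n-1)/3\rfloor$ if $n/2<\ell\le(2n-2)/3$. These estimates are best possible. Here "best possible" means that for all integers $n,\ell$ in the respective case there is a zero-free sequence of length $\ell$ in $\mathbb{Z}_n$ in which the maximum multiplicity of a generator equals the stated bound.
   Context: $\mathbb{Z}_n=\mathbb{Z}/n\mathbb{Z}$ is the additive group of integers modulo $n$. A generator is an element of $\mathbb{Z}_n$ with order $n$. Sequences are finite, and terms may repeat; the multiplicity of a term is the number of its occurrences in the sequence. A sequence in $\mathbb{Z}_n$ is zero-free if no nonempty subsequence of it has sum equal to the zero element of $\mathbb{Z}_n$ (a subsequence is obtained by choosing a set of indices). $\lfloor x\rfloor$ denotes the greatest integer not exceeding $x$. *)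

theory Defs
  imports Complex_Main "HOL-Algebra.Elementary_Groups" "HOL-Algebra.Multiplicative_Group"
begin

text \<open>
  The group of integers modulo \<open>n\<close> is \<open>integer_mod_group n\<close>. It is written multiplicatively, so that
  the zero element is \<open>\<one>\<close> and a sum of terms is a \<open>finprod\<close>.
\<close>

definition zmod_generators :: "nat \<Rightarrow> int set" where
  "zmod_generators n =
     {g \<in> carrier (integer_mod_group n). group.ord (integer_mod_group n) g = n}"

text \<open>
  Subsequences are given by sets of indices, so repeated terms are counted separately.
\<close>

definition zero_free :: "('a, 'b) monoid_scheme \<Rightarrow> 'a list \<Rightarrow> bool" where
  "zero_free G \<alpha> \<longleftrightarrow>
     set \<alpha> \<subseteq> carrier G \<and>
     (\<forall>I. I \<subseteq> {..<length \<alpha>} \<and> I \<noteq> {} \<longrightarrow> finprod G (\<lambda>i. \<alpha> ! i) I \<noteq> \<one>\<^bsub>G\<^esub>)"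

definition generator_of_mult_ge :: "nat \<Rightarrow> int list \<Rightarrow> int \<Rightarrow> bool" where
  "generator_of_mult_ge n \<alpha> b \<longleftrightarrow>
     (\<exists>g \<in> set \<alpha>. g \<in> zmod_generators n \<and> int (count_list \<alpha> g) \<ge> b)"

text \<open>
  Generators that do not occur in the sequence contribute multiplicity 0 to the maximum.
\<close>

definition max_generator_mult :: "nat \<Rightarrow> int list \<Rightarrow> nat" where
  "max_generator_mult n \<alpha> = Max (count_list \<alpha> ` zmod_generators n)"

definition bound_attained :: "nat \<Rightarrow> nat \<Rightarrow> int \<Rightarrow> bool" where
  "bound_attained n l b \<longleftrightarrow>
     (\<exists>\<alpha>. zero_free (integer_mod_group n) \<alpha> \<and> length \<alpha> = l \<and>
          int (max_generator_mult n \<alpha>) = b)"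

end

theory Submission
  imports Defs
begin

text \<open>
  Everything rests on the structure theorem of Savchev and Chen, \<open>long_zero_free_structure\<close>: the
  terms of a zero-free sequence of length \<open>l > n/2\<close> are \<open>y j * b\<close> for a single generator \<open>b\<close> and
  positive integers \<open>y j\<close> whose sum, taken over the integers, is less than \<open>n\<close>. The bounds are then
  a matter of counting: few terms equal to \<open>b\<close> force many \<open>y j \<ge> 2\<close>, and hence a large sum. If \<open>n\<close>
  is odd, \<open>2 * b\<close> is a generator too, and the sum is large as soon as neither \<open>b\<close> nor \<open>2 * b\<close> is
  frequent. Sequences of ones, twos and threes with sum less than \<open>n\<close> show that the bounds are sharp.

  The proof of the structure theorem watches the set of residues that are sums of (possibly empty)
  subsequences. Appending a term to a zero-free sequence always adds at least one residue; the
  step is called thin if it adds exactly one. Two facts are combined.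

  \<^item> Uniqueness (\<open>thin_removals_agree\<close>): if removing \<open>b\<close> and removing \<open>c\<close> from the sequence are both
    thin steps, then \<open>b\<close> and \<open>c\<close> are the same residue. For then the same residue, the total, is lost,
    and shifting by \<open>b\<close> and by \<open>c\<close> acts in the same way on what remains.

  \<^item> Existence (\<open>thin_removal_outside\<close>): if a subsequence \<open>I\<close> has at least \<open>2 * card I\<close> sums, then
    some term outside \<open>I\<close> is removed by a thin step. There is no room for every term to contribute
    two residues, as there are only \<open>n < 2 * l\<close> of them.

  Existence with empty \<open>I\<close> gives a thin term \<open>b\<close>, of multiplicity \<open>e\<close> say. If some term \<open>x\<close> were not
  one of \<open>b, 2 * b, ..., e * b\<close>, then the \<open>e\<close> copies of \<open>b\<close> together with \<open>x\<close> would have \<open>2 * e + 2\<close>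
  sums, and existence would produce a second thin term different from \<open>b\<close>, against uniqueness. So
  all terms are \<open>y j * b\<close> with \<open>1 \<le> y j \<le> e\<close>. As \<open>e\<close> of the \<open>y j\<close> are equal to 1, the subsequence
  sums of \<open>y\<close> fill the whole interval from 0 to the total, and zero-freeness keeps this
  interval below the order of \<open>b\<close>.
\<close>

section \<open>Subsequence sums modulo n\<close>

text \<open>
  A family of integers indexed by \<open>J\<close> stands for a sequence of residues; congruences are written as
  divisibilities of differences.
\<close>

locale zero_free_mod =
  fixes n :: int and a :: "'i \<Rightarrow> int" and J :: "'i set"
  assumes n_pos: "0 < n"
    and finite_J: "finite J"
    and zero_free: "\<And>T. T \<subseteq> J \<Longrightarrow> T \<noteq> {} \<Longrightarrow> \<not> n dvd sum a T"
begin

definition attains :: "'i set \<Rightarrow> int \<Rightarrow> bool" where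
  "attains I x \<longleftrightarrow> (\<exists>T\<subseteq>I. n dvd x - sum a T)"

text \<open>
  The empty subsequence is admitted, so 0 is always a member and the set can meet every residue
  even for a zero-free family.
\<close>
definition sum_residues :: "'i set \<Rightarrow> int set" where
  "sum_residues I = {x \<in> {0..<n}. attains I x}"

text \<open>
  The least possible growth of the set of sums, by the lemma \<open>card_sum_residues_insert_ge\<close> below.
\<close>
definition thin :: "'i \<Rightarrow> 'i set \<Rightarrow> bool" where
  "thin i I \<longleftrightarrow> card (sum_residues (insert i I)) = card (sum_residues I) + 1"

lemma finite_subset_J: "I \<subseteq> J \<Longrightarrow> finite I"
  using finite_J finite_subset by blast

lemma term_nonzero: "i \<in> J \<Longrightarrow> \<not> n dvd a i"
  using zero_free[of "{i}"] by simp

lemma attains_cong: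
  assumes "attains I x" "n dvd x - y"
  shows "attains I y"
proof -
  obtain T where T: "T \<subseteq> I" "n dvd x - sum a T"
    using assms(1) by (auto simp: attains_def)
  have "n dvd y - sum a T"
    using dvd_diff[OF T(2) assms(2)] by (simp add: algebra_simps)
  then show ?thesis
    using T(1) by (auto simp: attains_def)
qed

lemma attains_mod [simp]: "attains I (x mod n) \<longleftrightarrow> attains I x"
proof -
  have "n dvd x mod n - x" "n dvd x - x mod n"
    by (auto simp: mod_eq_dvd_iff[symmetric])
  then show ?thesis
    using attains_cong by blast
qed

lemma attains_mono: "attains I x \<Longrightarrow> I \<subseteq> I' \<Longrightarrow> attains I' x"
  by (auto simp: attains_def)

lemma attains_zero: "attains I 0"
  unfolding attains_def by (rule exI[of _ "{}"]) simp

lemma attains_insert: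
  assumes "finite I" "i \<notin> I"
  shows "attains (insert i I) x \<longleftrightarrow> attains I x \<or> attains I (x - a i)"
proof
  assume "attains (insert i I) x"
  then obtain T where T: "T \<subseteq> insert i I" "n dvd x - sum a T"
    by (auto simp: attains_def)
  show "attains I x \<or> attains I (x - a i)"
  proof (cases "i \<in> T")
    case True
    have "finite T" using T(1) assms(1) by (meson finite_insert finite_subset)
    then have "sum a T = a i + sum a (T - {i})"
      using True by (simp add: sum.remove)
    then have "n dvd (x - a i) - sum a (T - {i})"
      using T(2) by (simp add: algebra_simps)
    moreover have "T - {i} \<subseteq> I" using T(1) by auto
    ultimately show ?thesis by (auto simp: attains_def)
  next
    case False
    then have "T \<subseteq> I" using T(1) by auto
    then show ?thesis using T(2) by (auto simp: attains_def)
  qed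
next
  assume "attains I x \<or> attains I (x - a i)"
  then show "attains (insert i I) x"
  proof
    assume "attains I x"
    then show ?thesis by (rule attains_mono) auto
  next
    assume "attains I (x - a i)"
    then obtain T where T: "T \<subseteq> I" "n dvd (x - a i) - sum a T"
      by (auto simp: attains_def)
    have "finite T" "i \<notin> T" using T(1) assms finite_subset by auto
    then have "n dvd x - sum a (insert i T)"
      using T(2) by (simp add: algebra_simps)
    moreover have "insert i T \<subseteq> insert i I" using T(1) by auto
    ultimately show ?thesis unfolding attains_def by blast
  qed
qed

lemma attains_complement:
  assumes "finite I" "attains I x"
  shows "attains I (sum a I - x)"
proof -
  obtain T where T: "T \<subseteq> I" "n dvd x - sum a T"
    using assms(2) by (auto simp: attains_def)
  have "sum a (I - T) = sum a I - sum a T"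
    using T(1) assms(1) by (simp add: sum_diff)
  then have "(sum a I - x) - sum a (I - T) = - (x - sum a T)" by simp
  then have "n dvd (sum a I - x) - sum a (I - T)"
    using T(2) by (metis dvd_minus_iff)
  then show ?thesis unfolding attains_def by blast
qed

text \<open>
  Together with the appended term, a subsequence with sum \<open>- a i\<close> would have sum zero. The next lemma
  is the mirror image under complements: the new total cannot be an old sum. This is why each
  appended term adds a residue.
\<close>
lemma not_attains_uminus:
  assumes "insert i I \<subseteq> J" "i \<notin> I"
  shows "\<not> attains I (- a i)"
proof
  assume "attains I (- a i)"
  then obtain T where T: "T \<subseteq> I" "n dvd - a i - sum a T"
    by (auto simp: attains_def)
  have "finite T" using T(1) assms(1) by (auto intro: finite_subset_J)
  moreover have "i \<notin> T" using T(1) assms(2) by auto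
  ultimately have "- a i - sum a T = - sum a (insert i T)"
    by simp
  then have "n dvd sum a (insert i T)" using T(2) by (metis dvd_minus_iff)
  moreover have "insert i T \<subseteq> J" using T(1) assms(1) by auto
  ultimately show False using zero_free by blast
qed

lemma not_attains_total:
  assumes "insert i I \<subseteq> J" "i \<notin> I"
  shows "\<not> attains I (sum a I + a i)"
proof
  assume *: "attains I (sum a I + a i)"
  have "finite I" using assms(1) by (auto intro: finite_subset_J)
  from attains_complement[OF this *] show False
    using not_attains_uminus[OF assms] by simp
qed

definition new_residues :: "'i \<Rightarrow> 'i set \<Rightarrow> int set" where
  "new_residues i I = {x \<in> {0..<n}. attains I (x - a i) \<and> \<not> attains I x}"

lemma finite_residues [simp]: "finite (sum_residues I)" "finite (new_residues i I)"
  by (rule finite_subset[of _ "{0..<n}"]; auto simp: sum_residues_def new_residues_def)+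

lemma card_sum_residues_le: "int (card (sum_residues I)) \<le> n"
proof -
  have "card (sum_residues I) \<le> card {0..<n}"
    by (rule card_mono) (auto simp: sum_residues_def)
  then show ?thesis using n_pos by simp
qed

lemma card_sum_residues_insert:
  assumes "finite I" "i \<notin> I"
  shows "card (sum_residues (insert i I)) = card (sum_residues I) + card (new_residues i I)"
proof -
  have "sum_residues (insert i I) = sum_residues I \<union> new_residues i I"
    using attains_insert[OF assms] by (auto simp: sum_residues_def new_residues_def)
  moreover have "sum_residues I \<inter> new_residues i I = {}"
    by (auto simp: sum_residues_def new_residues_def)
  ultimately show ?thesis by (simp add: card_Un_disjoint)
qed

lemma mod_in_new_residues_iff:
  "x mod n \<in> new_residues i I \<longleftrightarrow> attains I (x - a i) \<and> \<not> attains I x"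
proof -
  have "attains I (x mod n - a i) \<longleftrightarrow> attains I (x - a i)"
    by (metis attains_mod mod_diff_left_eq)
  then show ?thesis using n_pos by (simp add: new_residues_def)
qed

lemma total_in_new_residues:
  assumes "insert i I \<subseteq> J" "i \<notin> I"
  shows "(sum a I + a i) mod n \<in> new_residues i I"
proof -
  have "finite I" using assms(1) by (auto intro: finite_subset_J)
  then have "attains I (sum a I)"
    using attains_complement[OF _ attains_zero] by force
  then show ?thesis
    using not_attains_total[OF assms] by (simp add: mod_in_new_residues_iff)
qed

text \<open>
  The total of the enlarged family is always new.
\<close>
lemma card_sum_residues_insert_ge:
  assumes "insert i I \<subseteq> J" "i \<notin> I"
  shows "card (sum_residues I) + 1 \<le> card (sum_residues (insert i I))"
proof -
  have "finite I" using assms(1) by (auto intro: finite_subset_J)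
  moreover have "0 < card (new_residues i I)"
    using total_in_new_residues[OF assms] by (auto simp: card_gt_0_iff)
  ultimately show ?thesis
    using card_sum_residues_insert[of I i] assms(2) by linarith
qed

lemma card_sum_residues_Un_ge:
  assumes "finite W" "U \<union> W \<subseteq> J" "U \<inter> W = {}"
  shows "card (sum_residues U) + card W \<le> card (sum_residues (U \<union> W))"
  using assms
proof (induction W rule: finite_induct)
  case (insert i W)
  have "card (sum_residues (U \<union> W)) + 1 \<le> card (sum_residues (insert i (U \<union> W)))"
    using insert.prems insert.hyps by (intro card_sum_residues_insert_ge) auto
  moreover have "card (sum_residues U) + card W \<le> card (sum_residues (U \<union> W))"
    using insert.prems by (intro insert.IH) auto
  ultimately show ?case using insert.hyps by simp
qed simp

lemma sum_residues_empty: "sum_residues {} = {0}"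
proof -
  have "attains {} x \<longleftrightarrow> n dvd x" for x
    by (simp add: attains_def)
  then show ?thesis
    using n_pos zdvd_imp_le by (auto simp: sum_residues_def) (metis linorder_not_less order_le_less zdvd_imp_le)
qed

lemma card_sum_residues_gt:
  assumes "I \<subseteq> J"
  shows "card I + 1 \<le> card (sum_residues I)"
  using card_sum_residues_Un_ge[of I "{}"] assms finite_subset_J
  by (simp add: sum_residues_empty)

section \<open>Thin steps\<close>

text \<open>
  In a thin step the only new sum is the total \<open>sum a I + a i\<close>. Hence shifting by \<open>a i\<close> maps the set
  of sums into itself, except that the old total is sent to the new one.
\<close>
lemma thin_forward:
  assumes "thin i I" "insert i I \<subseteq> J" "i \<notin> I" "attains I (x - a i)"
  shows "attains I x \<or> n dvd x - (sum a I + a i)"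
proof (rule disjCI)
  assume new: "\<not> n dvd x - (sum a I + a i)"
  show "attains I x"
  proof (rule ccontr)
    assume "\<not> attains I x"
    then have "x mod n \<in> new_residues i I"
      using assms(4) by (simp add: mod_in_new_residues_iff)
    moreover have "finite I" using assms(2) by (auto intro: finite_subset_J)
    then have "card (new_residues i I) = 1"
      using assms(1,3) card_sum_residues_insert[of I i] by (simp add: thin_def)
    ultimately have "x mod n = (sum a I + a i) mod n"
      using total_in_new_residues[OF assms(2,3)] by (metis card_1_singletonE singletonD)
    then show False using new by (simp add: mod_eq_dvd_iff)
  qed
qed

text \<open>
  The previous lemma read through the symmetry \<open>x \<mapsto> sum a I - x\<close> of the set of sums: shifting by
  \<open>- a i\<close> also preserves it, except at 0.
\<close>
lemma thin_backward:
  assumes "thin i I" "insert i I \<subseteq> J" "i \<notin> I" "attains I x" "\<not> n dvd x"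
  shows "attains I (x - a i)"
proof -
  have fin: "finite I" using assms(2) by (auto intro: finite_subset_J)
  have "attains I ((sum a I - x + a i) - a i)"
    using attains_complement[OF fin assms(4)] by simp
  then have "attains I (sum a I - x + a i) \<or> n dvd (sum a I - x + a i) - (sum a I + a i)"
    using thin_forward[OF assms(1-3)] by blast
  moreover have "(sum a I - x + a i) - (sum a I + a i) = - x" by simp
  ultimately have "attains I (sum a I - x + a i)"
    using assms(5) by (simp only: dvd_minus_iff) blast
  from attains_complement[OF fin this] show ?thesis by (simp add: algebra_simps)
qed

text \<open>
  If \<open>a i\<close> and \<open>a j\<close> differed, then \<open>a i\<close>, \<open>a i - a j\<close> and finally \<open>- a j\<close> would all be sums: the
  first because 0 is one and the old total is nonzero, the others by shifting backwards. But \<open>- a j\<close>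
  cannot be a sum.
\<close>
lemma thin_extensions_agree:
  assumes "I \<subseteq> J" "I \<noteq> {}" "i \<in> J - I" "j \<in> J - I" "thin i I" "thin j I"
  shows "n dvd a i - a j"
proof (rule ccontr)
  assume neq: "\<not> n dvd a i - a j"
  have "attains I (a i - a i)" using attains_zero by simp
  then have "attains I (a i) \<or> n dvd a i - (sum a I + a i)"
    using assms by (intro thin_forward) auto
  moreover have "\<not> n dvd sum a I" using zero_free assms by blast
  ultimately have "attains I (a i)" by simp
  then have "attains I (a i - a j)"
    using assms term_nonzero by (intro thin_backward) auto
  then have "attains I (a i - a j - a i)"
    using thin_backward[of i I "a i - a j"] assms neq by blast
  then have "attains I (- a j)" by simp
  moreover have "\<not> attains I (- a j)" using assms by (intro not_attains_uminus) auto
  ultimately show False by blast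
qed

text \<open>
  The same chain of shifts as before, started from \<open>a j\<close>, now shows that \<open>- a i\<close> is a sum over
  \<open>J - {j}\<close>. Since it is not a sum over \<open>J - {i}\<close>, it has to be the one residue that disappears with
  \<open>i\<close>, namely the total of \<open>J\<close>; but this total disappears with \<open>j\<close> as well.
\<close>
lemma thin_removals_agree:
  assumes "i \<in> J" "j \<in> J" "thin i (J - {i})" "thin j (J - {j})"
  shows "n dvd a i - a j"
proof (rule ccontr)
  assume neq: "\<not> n dvd a i - a j"
  have ins: "insert i (J - {i}) = J" "insert j (J - {j}) = J" using assms by auto
  have step: "attains (J - {k}) (x - a k)"
    if "k \<in> J" "thin k (J - {k})" "attains J x" "\<not> n dvd x" for k x
  proof -
    have "attains (J - {k}) x \<or> attains (J - {k}) (x - a k)"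
      using attains_insert[of "J - {k}" k x] that finite_J by (simp add: insert_absorb)
    moreover have "insert k (J - {k}) \<subseteq> J" using that by auto
    ultimately show ?thesis using thin_backward[of k "J - {k}" x] that by auto
  qed
  have up: "attains J x" if "attains (J - {k}) x" for k x
    using attains_mono[OF that] by auto
  have "attains J (a j)"
    unfolding attains_def using assms(2) by (intro exI[of _ "{j}"]) simp
  then have "attains J (a j - a i)"
    using step up assms term_nonzero by blast
  moreover have "\<not> n dvd a j - a i" using neq by (simp add: dvd_diff_commute)
  ultimately have neg: "attains (J - {j}) (- a i)"
    using step[of j "a j - a i"] assms by simp
  have no: "\<not> attains (J - {i}) (- a i)" using assms by (intro not_attains_uminus) auto
  have "attains (J - {i}) (- a i - a i)"
    using attains_insert[of "J - {i}" i "- a i"] ins up[OF neg] no finite_J by simp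
  moreover have "sum a (J - {i}) + a i = sum a J" "sum a (J - {j}) + a j = sum a J"
    using sum.remove[OF finite_J assms(1), of a] sum.remove[OF finite_J assms(2), of a] by linarith+
  ultimately have "n dvd - a i - sum a J"
    using thin_forward[of i "J - {i}" "- a i"] assms no by auto
  then have "attains (J - {j}) (sum a J)" using attains_cong[OF neg] by simp
  then show False
    using not_attains_total[of j "J - {j}"] assms \<open>sum a (J - {j}) + a j = sum a J\<close> by auto
qed

text \<open>
  Thinness persists when further copies of the same residue are appended: every copy adds
  just the next total \<open>sum a U + k * a i\<close>.
\<close>
lemma attains_Un_constant:
  assumes "finite W" "U \<union> W \<subseteq> J" "U \<inter> W = {}" "i \<in> W" "thin i U"
    and const: "\<And>j. j \<in> W \<Longrightarrow> n dvd a j - a i"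
    and "attains (U \<union> W) x"
  shows "attains U x \<or> (\<exists>k\<in>{1..card W}. n dvd x - (sum a U + int k * a i))"
proof -
  have i: "insert i U \<subseteq> J" "i \<notin> U" using assms by auto
  have "attains U x \<or> (\<exists>k\<in>{1..card W'}. n dvd x - (sum a U + int k * a i))"
    if "finite W'" "W' \<subseteq> W" "attains (U \<union> W') x" for W' x
    using that
  proof (induction W' arbitrary: x rule: finite_induct)
    case (insert j W')
    have fin: "finite (U \<union> W')" using insert assms by (auto intro: finite_subset_J)
    have j: "j \<notin> U \<union> W'" using insert assms by auto
    have ji: "n dvd a j - a i" using const insert by auto
    from attains_insert[OF fin j, of x] insert.prems
    consider "attains (U \<union> W') x" | "attains (U \<union> W') (x - a j)" by auto
    then show ?case
    proof cases
      case 1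
      then show ?thesis using insert.IH[of x] insert.prems insert.hyps by fastforce
    next
      case 2
      have "attains (U \<union> W') (x - a i)"
        by (rule attains_cong[OF 2]) (use ji in \<open>simp add: dvd_diff_commute\<close>)
      then consider "attains U (x - a i)"
        | k where "k \<in> {1..card W'}" "n dvd x - a i - (sum a U + int k * a i)"
        using insert.IH[of "x - a i"] insert.prems by auto
      then show ?thesis
      proof cases
        case 1
        from thin_forward[OF assms(5) i this]
        have "attains U x \<or> n dvd x - (sum a U + int 1 * a i)" by simp
        then show ?thesis using insert.hyps by fastforce
      next
        case 2
        then have "n dvd x - (sum a U + int (k + 1) * a i)" by (simp add: algebra_simps)
        moreover have "k + 1 \<in> {1..card (insert j W')}" using 2 insert.hyps by simp
        ultimately show ?thesis by blast
      qed
    qed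
  qed simp
  then show ?thesis using assms by blast
qed

lemma card_sum_residues_Un_constant:
  assumes "finite W" "U \<union> W \<subseteq> J" "U \<inter> W = {}" "i \<in> W" "thin i U"
    and "\<And>j. j \<in> W \<Longrightarrow> n dvd a j - a i"
  shows "card (sum_residues (U \<union> W)) \<le> card (sum_residues U) + card W"
proof -
  let ?extra = "(\<lambda>k. (sum a U + int k * a i) mod n) ` {1..card W}"
  have "sum_residues (U \<union> W) \<subseteq> sum_residues U \<union> ?extra"
  proof
    fix x assume x: "x \<in> sum_residues (U \<union> W)"
    then have range: "x \<in> {0..<n}" "x mod n = x" by (auto simp: sum_residues_def)
    have "attains U x \<or> (\<exists>k\<in>{1..card W}. n dvd x - (sum a U + int k * a i))"
      using attains_Un_constant[OF assms] x by (simp add: sum_residues_def)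
    then have "attains U x \<or> (\<exists>k\<in>{1..card W}. x = (sum a U + int k * a i) mod n)"
      unfolding mod_eq_dvd_iff[symmetric] range(2) .
    then show "x \<in> sum_residues U \<union> ?extra"
      using range(1) unfolding sum_residues_def by blast
  qed
  then have "card (sum_residues (U \<union> W)) \<le> card (sum_residues U \<union> ?extra)"
    by (intro card_mono) auto
  also have "\<dots> \<le> card (sum_residues U) + card ?extra" by (rule card_Un_le)
  also have "\<dots> \<le> card (sum_residues U) + card W"
    using card_image_le[of "{1..card W}" "\<lambda>k. (sum a U + int k * a i) mod n"] by simp
  finally show ?thesis .
qed

text \<open>
  Extend \<open>I\<close> to a largest \<open>U\<close> with at least \<open>2 * card U\<close> sums. As \<open>J\<close> itself would need more than \<open>n\<close>
  sums, terms are left over. By maximality each of them is a thin extension of \<open>U\<close>, hence all of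
  them agree modulo \<open>n\<close>, and appending them one after the other is thin up to the last step.
\<close>
lemma thin_removal_outside:
  assumes "I \<subseteq> J" "2 * card I \<le> card (sum_residues I)" and long: "n < 2 * int (card J)"
  shows "\<exists>i\<in>J - I. thin i (J - {i})"
proof -
  define P where "P U \<longleftrightarrow> I \<subseteq> U \<and> U \<subseteq> J \<and> 2 * card U \<le> card (sum_residues U)" for U
  have bounded: "\<forall>U. P U \<longrightarrow> card U < card J + 1"
    by (auto simp: P_def less_Suc_eq_le intro: card_mono finite_J)
  have "P I" using assms by (simp add: P_def)
  then obtain U where U: "P U" and max: "\<And>U'. P U' \<Longrightarrow> card U' \<le> card U"
    using ex_has_greatest_nat[OF _ bounded] by blast
  have "U \<subseteq> J" using U by (simp add: P_def)
  then have "finite U" by (rule finite_subset_J)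
  have "U \<noteq> J" using U long card_sum_residues_le[of J] by (auto simp: P_def)
  have step: "card (sum_residues U) = 2 * card U" "thin i U" if "i \<in> J - U" for i
  proof -
    have "card (insert i U) = card U + 1" using that \<open>finite U\<close> by simp
    then have "\<not> P (insert i U)" using max[of "insert i U"] by linarith
    then have "card (sum_residues (insert i U)) < 2 * card (insert i U)"
      using U that by (auto simp: P_def not_le)
    then have "card (sum_residues (insert i U)) < 2 * card U + 2"
      using that \<open>finite U\<close> by simp
    moreover have "card (sum_residues U) + 1 \<le> card (sum_residues (insert i U))"
      using that \<open>U \<subseteq> J\<close> by (intro card_sum_residues_insert_ge) auto
    moreover have "2 * card U \<le> card (sum_residues U)" using U by (simp add: P_def)
    ultimately show "card (sum_residues U) = 2 * card U" "thin i U"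
      by (auto simp: thin_def)
  qed
  obtain i where i: "i \<in> J - U" using \<open>U \<noteq> J\<close> \<open>U \<subseteq> J\<close> by auto
  have "U \<noteq> {}" using step(1)[OF i] sum_residues_empty by auto
  have const: "n dvd a j - a i" if "j \<in> J - U" for j
    using that i step(2) \<open>U \<subseteq> J\<close> \<open>U \<noteq> {}\<close> by (intro thin_extensions_agree) auto
  have "finite (J - U)" using finite_J by simp
  have upper: "card (sum_residues J) \<le> card (sum_residues U) + card (J - U)"
    using card_sum_residues_Un_constant[of "J - U" U i] \<open>U \<subseteq> J\<close> i step(2) const finite_J
    by (simp add: Un_absorb1)
  have "card (sum_residues U) + card (J - U - {i}) \<le> card (sum_residues (U \<union> (J - U - {i})))"
    using \<open>U \<subseteq> J\<close> finite_J by (intro card_sum_residues_Un_ge) auto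
  moreover have "U \<union> (J - U - {i}) = J - {i}" using \<open>U \<subseteq> J\<close> i by auto
  moreover have "card (J - U) = card (J - U - {i}) + 1"
    using i finite_J by (metis Suc_eq_plus1 \<open>finite (J - U)\<close> card_Suc_Diff1)
  moreover have "card (sum_residues (J - {i})) + 1 \<le> card (sum_residues (insert i (J - {i})))"
    using i by (intro card_sum_residues_insert_ge) auto
  moreover have "insert i (J - {i}) = J" using i by auto
  ultimately have "thin i (J - {i})" using upper by (simp add: thin_def)
  moreover have "i \<in> J - I" using i U by (auto simp: P_def)
  ultimately show ?thesis by blast
qed

section \<open>The structure of long zero-free sequences\<close>

lemma sum_cong_multiple:
  assumes "\<And>j. j \<in> T \<Longrightarrow> n dvd a j - int (y j) * b"
  shows "n dvd sum a T - int (sum y T) * b"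
proof -
  have "sum a T - int (sum y T) * b = (\<Sum>j\<in>T. a j - int (y j) * b)"
    by (simp add: sum_subtractf sum_distrib_right)
  then show ?thesis using assms by (simp add: dvd_sum)
qed

text \<open>
  If \<open>x\<close> is not such a multiple, the sums over \<open>E\<close> and their shifts by \<open>a x\<close> are disjoint. Then
  \<open>insert x E\<close> has twice as many sums as indices, so that another term is removed by a thin step.
  Lying outside \<open>E\<close>, it contradicts uniqueness.
\<close>
lemma terms_multiples_of_thin_term:
  assumes long: "n < 2 * int (card J)"
    and i: "i \<in> J" "thin i (J - {i})"
    and x: "x \<in> J"
  defines "E \<equiv> {j \<in> J. n dvd a j - a i}"
  shows "\<exists>k\<in>{1..card E}. n dvd a x - int k * a i"
proof (rule ccontr)
  assume not_mult: "\<not> ?thesis"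
  have E: "E \<subseteq> J" "finite E" "i \<in> E" using finite_J i by (auto simp: E_def)
  then have "1 \<le> card E" by (metis One_nat_def Suc_leI card_gt_0_iff empty_iff)
  have E_cong: "n dvd sum a T - int (card T) * a i" if "T \<subseteq> E" for T
    using sum_cong_multiple[of T "\<lambda>_. 1" "a i"] that by (auto simp: E_def)
  have "x \<notin> E"
  proof
    assume "x \<in> E"
    then have "n dvd a x - int 1 * a i" by (simp add: E_def)
    then show False using not_mult \<open>1 \<le> card E\<close> by (metis atLeastAtMost_iff order_refl)
  qed
  have disjoint: "\<not> attains E u" if u: "attains E (u - a x)" for u
  proof
    assume "attains E u"
    then obtain S where S: "S \<subseteq> E" "n dvd u - sum a S" by (auto simp: attains_def)
    obtain T where T: "T \<subseteq> E" "n dvd (u - a x) - sum a T"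
      using u by (auto simp: attains_def)
    have "n dvd (u - sum a S) + (sum a S - int (card S) * a i)"
      using S E_cong by (intro dvd_add) auto
    moreover have "n dvd ((u - a x) - sum a T) + (sum a T - int (card T) * a i)"
      using T E_cong by (intro dvd_add) auto
    ultimately have "n dvd ((u - sum a S) + (sum a S - int (card S) * a i))
        - (((u - a x) - sum a T) + (sum a T - int (card T) * a i))"
      by (rule dvd_diff)
    then have ax: "n dvd a x - (int (card S) - int (card T)) * a i"
      by (simp add: algebra_simps)
    have "card S \<le> card E" "card T \<le> card E" using S T E card_mono by auto
    \<comment> \<open>\<open>a x\<close> is an integer multiple of \<open>a i\<close> with factor between \<open>- card E\<close> and \<open>card E\<close>. A positive
      factor is excluded by assumption; for the other factors copies of \<open>a i\<close> cancel \<open>a x\<close>.\<close>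
    show False
    proof (cases "card T < card S")
      case True
      with \<open>card S \<le> card E\<close> have "card S - card T \<in> {1..card E}" by auto
      moreover have "n dvd a x - int (card S - card T) * a i"
        using ax True by (simp add: of_nat_diff)
      ultimately show False using not_mult by blast
    next
      case False
      have "card T - card S \<le> card E" using \<open>card T \<le> card E\<close> by simp
      then obtain D where D: "D \<subseteq> E" "card D = card T - card S"
        by (rule obtain_subset_with_card_n)
      have "n dvd (a x - (int (card S) - int (card T)) * a i) + (sum a D - int (card D) * a i)"
        using ax E_cong[OF D(1)] by (rule dvd_add)
      moreover have "sum a (insert x D) = a x + sum a D"
        using D E \<open>x \<notin> E\<close> finite_subset by (subst sum.insert) auto
      ultimately have "n dvd sum a (insert x D)"
        using False D by (simp add: of_nat_diff algebra_simps)
      moreover have "insert x D \<subseteq> J" using D E x by auto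
      ultimately show False using zero_free by blast
    qed
  qed
  have "new_residues x E = (\<lambda>u. (u + a x) mod n) ` sum_residues E"
  proof (intro equalityI subsetI)
    fix v assume v: "v \<in> new_residues x E"
    then have "(v - a x) mod n \<in> sum_residues E"
      using n_pos by (simp add: sum_residues_def new_residues_def)
    moreover have "v = ((v - a x) mod n + a x) mod n"
      using v by (simp add: new_residues_def mod_add_left_eq)
    ultimately show "v \<in> (\<lambda>u. (u + a x) mod n) ` sum_residues E" by blast
  next
    fix v assume "v \<in> (\<lambda>u. (u + a x) mod n) ` sum_residues E"
    then obtain u where "v = (u + a x) mod n" "attains E u"
      by (auto simp: sum_residues_def)
    then show "v \<in> new_residues x E"
      using disjoint[of "u + a x"] by (simp add: mod_in_new_residues_iff)
  qed
  moreover have "inj_on (\<lambda>u. (u + a x) mod n) (sum_residues E)"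
  proof (rule inj_onI)
    fix u v assume uv: "u \<in> sum_residues E" "v \<in> sum_residues E"
      and "(u + a x) mod n = (v + a x) mod n"
    then have "u mod n = v mod n" by (simp add: mod_eq_dvd_iff)
    then show "u = v" using uv by (simp add: sum_residues_def)
  qed
  ultimately have "card (sum_residues (insert x E)) = 2 * card (sum_residues E)"
    using card_sum_residues_insert[OF E(2) \<open>x \<notin> E\<close>] by (simp add: card_image)
  moreover have "card E + 1 \<le> card (sum_residues E)" using card_sum_residues_gt E by blast
  ultimately have "2 * card (insert x E) \<le> card (sum_residues (insert x E))"
    using E \<open>x \<notin> E\<close> by simp
  moreover have "insert x E \<subseteq> J" using E x by auto
  ultimately obtain j where j: "j \<in> J - insert x E" "thin j (J - {j})"
    using thin_removal_outside[OF _ _ long] by blast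
  then have "n dvd a j - a i" using thin_removals_agree i by blast
  then show False using j by (auto simp: E_def)
qed

end

text \<open>
  The ones yield all values up to \<open>card E\<close>, and each further \<open>y j\<close>, being at most \<open>card E\<close>, prolongs
  the interval without leaving a gap.
\<close>
lemma subset_sums_fill_interval:
  fixes y :: "'i \<Rightarrow> nat"
  assumes "finite W" "finite E" "E \<inter> W = {}"
    and "\<And>j. j \<in> E \<Longrightarrow> y j = 1" and "\<And>j. j \<in> W \<Longrightarrow> y j \<le> card E"
    and "k \<le> sum y (E \<union> W)"
  shows "\<exists>T\<subseteq>E \<union> W. sum y T = k"
  using assms
proof (induction W arbitrary: k rule: finite_induct)
  case empty
  have ones: "sum y T = card T" if "T \<subseteq> E" for T using empty that by (simp add: subset_iff)
  then have "k \<le> card E" using empty by simp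
  then obtain T where "T \<subseteq> E" "card T = k" by (rule obtain_subset_with_card_n)
  then show ?case using ones by auto
next
  case (insert j W)
  have j: "j \<notin> E \<union> W" "y j \<le> card E" using insert by auto
  have total: "sum y (E \<union> insert j W) = y j + sum y (E \<union> W)" using insert j by simp
  have IH: "\<exists>T\<subseteq>E \<union> W. sum y T = k'" if "k' \<le> sum y (E \<union> W)" for k'
    using insert.IH[of k'] insert.prems that by auto
  show ?case
  proof (cases "k \<le> sum y (E \<union> W)")
    case True
    then show ?thesis using IH by blast
  next
    case False
    have "card E \<le> sum y (E \<union> W)"
    proof -
      have "card E = sum y E" using insert.prems by simp
      also have "\<dots> \<le> sum y (E \<union> W)" using insert by (intro sum_mono2) auto
      finally show ?thesis .
    qed
    have "k - y j \<le> sum y (E \<union> W)" using insert.prems(5) total by linarith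
    then obtain T where T: "T \<subseteq> E \<union> W" "sum y T = k - y j" using IH by blast
    have "finite T" using T insert finite_subset by (metis finite_Un)
    then have "sum y (insert j T) = k"
      using T j False \<open>card E \<le> sum y (E \<union> W)\<close> by (subst sum.insert) auto
    moreover have "insert j T \<subseteq> E \<union> insert j W" using T by auto
    ultimately show ?thesis by blast
  qed
qed

text \<open>
  The theorem of Savchev and Chen. By the previous lemma every \<open>k\<close> with \<open>1 \<le> k \<le> sum y J\<close> is the sum of
  \<open>y\<close> over a nonempty set of indices, so \<open>k * b\<close> is not zero modulo \<open>n\<close>. Taking \<open>k = n\<close> bounds the
  sum. Taking \<open>k = n div gcd b n\<close>, which is at most \<open>n / 2 < card J \<le> sum y J\<close> unless \<open>b\<close> is a generator,
  shows that \<open>b\<close> is one.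
\<close>
theorem (in zero_free_mod) long_zero_free_structure:
  assumes long: "n < 2 * int (card J)"
  obtains b y where "coprime b n" "\<And>j. j \<in> J \<Longrightarrow> 1 \<le> y j"
    "\<And>j. j \<in> J \<Longrightarrow> n dvd a j - int (y j) * b" "int (sum y J) < n"
proof -
  obtain i where i: "i \<in> J" "thin i (J - {i})"
    using thin_removal_outside[of "{}"] long by auto
  define b where "b = a i"
  define E where "E = {j \<in> J. n dvd a j - b}"
  have E: "E \<subseteq> J" "finite E" "i \<in> E" using finite_J i by (auto simp: E_def b_def)
  then have "1 \<le> card E" by (metis One_nat_def Suc_leI card_gt_0_iff empty_iff)
  have "\<forall>j\<in>J. \<exists>k\<in>{1..card E}. n dvd a j - int k * b"
    using terms_multiples_of_thin_term[OF long i] by (simp add: E_def b_def)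
  then obtain y0 where y0: "\<And>j. j \<in> J \<Longrightarrow> y0 j \<in> {1..card E}"
      "\<And>j. j \<in> J \<Longrightarrow> n dvd a j - int (y0 j) * b"
    by metis
  \<comment> \<open>On \<open>E\<close> the factor has to be exactly 1 for the subsequence sums of \<open>y\<close> to start without gaps.\<close>
  define y where "y j = (if j \<in> E then 1 else y0 j)" for j
  have y: "1 \<le> y j" "y j \<le> card E" "n dvd a j - int (y j) * b" if "j \<in> J" for j
    using y0[OF that] that \<open>1 \<le> card E\<close> by (auto simp: y_def E_def)
  have no_zero: "\<not> n dvd int k * b" if k_bounds: "1 \<le> k" "k \<le> sum y J" for k
  proof
    assume k: "n dvd int k * b"
    have "E \<union> (J - E) = J" using E by auto
    moreover have "\<And>j. j \<in> E \<Longrightarrow> y j = 1" by (simp add: y_def)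
    ultimately obtain T where T: "T \<subseteq> J" "sum y T = k"
      using subset_sums_fill_interval[of "J - E" E y k] finite_J E(2) y(2) k_bounds(2) by auto
    have "n dvd sum a T - int k * b" using sum_cong_multiple[of T y b] T y by auto
    then have "n dvd sum a T" using k by (metis diff_add_cancel dvd_add)
    moreover have "T \<noteq> {}" using T k_bounds by auto
    ultimately show False using zero_free T by blast
  qed
  have "card J \<le> sum y J" using sum_mono[of J "\<lambda>_. 1" y] y by simp
  have "int (sum y J) < n"
  proof (rule ccontr)
    assume "\<not> int (sum y J) < n"
    then have "1 \<le> nat n" "nat n \<le> sum y J" using n_pos by linarith+
    then show False using no_zero[of "nat n"] n_pos by simp
  qed
  moreover have "coprime b n"
  proof (rule ccontr)
    assume "\<not> coprime b n"
    define d where "d = gcd b n"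
    have "0 < d" "d \<noteq> 1" using \<open>\<not> coprime b n\<close> n_pos by (auto simp: d_def coprime_iff_gcd_eq_1)
    obtain b' m where bm: "b = d * b'" "n = d * m" by (metis d_def gcd_dvd1 gcd_dvd2 dvdE)
    have "0 < m" using bm n_pos \<open>0 < d\<close> by (simp add: zero_less_mult_iff)
    moreover have "2 * m \<le> n" using bm \<open>0 < d\<close> \<open>d \<noteq> 1\<close> \<open>0 < m\<close> by (simp add: mult_right_mono)
    moreover have "n dvd int (nat m) * b" using bm \<open>0 < m\<close> by (simp add: mult.assoc mult.left_commute)
    ultimately show False using no_zero[of "nat m"] long \<open>card J \<le> sum y J\<close> by linarith
  qed
  ultimately show thesis using that y by blast
qed

section \<open>Multiplicities of generators\<close>

lemma finprod_integer_mod_group: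
  assumes "finite I" "\<And>i. i \<in> I \<Longrightarrow> f i \<in> carrier (integer_mod_group n)"
  shows "finprod (integer_mod_group n) f I = (\<Sum>i\<in>I. f i) mod int n"
proof -
  interpret comm_group "integer_mod_group n" by simp
  show ?thesis
    using assms
  proof (induction I rule: finite_induct)
    case (insert i I)
    then have "finprod (integer_mod_group n) f (insert i I)
        = (f i + finprod (integer_mod_group n) f I) mod int n"
      by (subst finprod_insert) auto
    also have "\<dots> = (\<Sum>i\<in>insert i I. f i) mod int n"
      using insert by (simp add: mod_add_right_eq)
    finally show ?case .
  qed simp
qed

lemma zmod_generators_iff:
  assumes "0 < n"
  shows "g \<in> zmod_generators n \<longleftrightarrow> g \<in> {0..<int n} \<and> coprime g (int n)"
proof -
  interpret group "integer_mod_group n" by simp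
  have carrier: "g \<in> carrier (integer_mod_group n) \<longleftrightarrow> g \<in> {0..<int n}" for g
    using assms by (simp add: carrier_integer_mod_group)
  have "ord g = n \<longleftrightarrow> coprime g (int n)" if g: "g \<in> carrier (integer_mod_group n)"
  proof -
    have ord_dvd: "ord g dvd k \<longleftrightarrow> int n dvd int k * g" for k
      using pow_eq_id[OF g, of k] by (simp add: dvd_eq_mod_eq_0)
    show ?thesis
    proof
      assume ord: "ord g = n"
      define d where "d = gcd g (int n)"
      obtain g' m where gm: "g = d * g'" "int n = d * m" by (metis d_def gcd_dvd1 gcd_dvd2 dvdE)
      have "0 < d" using assms by (simp add: d_def)
      then have "0 < m" using gm(2) assms by (metis of_nat_0_less_iff zero_less_mult_pos)
      have "int n dvd int (nat m) * g" using gm \<open>0 < m\<close> by (simp add: mult.left_commute)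
      then have "int n dvd m" using ord ord_dvd[of "nat m"] \<open>0 < m\<close>
        by (metis int_dvd_int_iff int_nat_eq order_less_imp_le)
      then have "d * m \<le> 1 * m" using zdvd_imp_le[of "int n" m] \<open>0 < m\<close> gm(2) by simp
      then have "d = 1" using \<open>0 < m\<close> \<open>0 < d\<close> by simp
      then show "coprime g (int n)" by (simp add: d_def coprime_iff_gcd_eq_1)
    next
      assume "coprime g (int n)"
      then have "int n dvd int k * g \<longleftrightarrow> n dvd k" for k
        by (simp add: coprime_dvd_mult_left_iff coprime_commute)
      then show "ord g = n" using ord_dvd by (metis dvd_antisym dvd_refl)
    qed
  qed
  then show ?thesis by (auto simp: zmod_generators_def carrier)
qed

lemma zero_free_imp_zero_free_mod:
  assumes "0 < n" "zero_free (integer_mod_group n) \<alpha>"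
  shows "zero_free_mod (int n) (\<lambda>i. \<alpha> ! i) {..<length \<alpha>}"
proof
  fix T assume T: "T \<subseteq> {..<length \<alpha>}" "T \<noteq> {}"
  then have "finite T" using finite_subset by blast
  moreover have "\<alpha> ! i \<in> carrier (integer_mod_group n)" if "i \<in> T" for i
    using that T(1) assms(2) nth_mem[of i \<alpha>] unfolding zero_free_def by blast
  ultimately have "finprod (integer_mod_group n) (\<lambda>i. \<alpha> ! i) T = (\<Sum>i\<in>T. \<alpha> ! i) mod int n"
    by (rule finprod_integer_mod_group)
  then show "\<not> int n dvd (\<Sum>i\<in>T. \<alpha> ! i)"
    using T assms(2) unfolding zero_free_def dvd_eq_mod_eq_0 one_integer_mod_group by metis
qed (use assms in auto)

lemma generator_of_mult_geI:
  assumes "0 < n" "set \<alpha> \<subseteq> {0..<int n}" "coprime c (int n)"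
    and S: "S \<subseteq> {..<length \<alpha>}" "S \<noteq> {}" "\<And>j. j \<in> S \<Longrightarrow> int n dvd \<alpha> ! j - c"
    and "r \<le> int (card S)"
  shows "generator_of_mult_ge n \<alpha> r"
proof -
  define g where "g = c mod int n"
  have S_eq: "\<alpha> ! j = g" if "j \<in> S" for j
  proof -
    have "\<alpha> ! j \<in> {0..<int n}" using that assms(2) S(1) by (meson lessThan_iff nth_mem subsetD)
    moreover have "\<alpha> ! j mod int n = g" using S(3)[OF that] by (simp add: g_def mod_eq_dvd_iff)
    ultimately show ?thesis by simp
  qed
  have "card S \<le> card {j. j < length \<alpha> \<and> \<alpha> ! j = g}"
    using S(1) S_eq by (intro card_mono) auto
  also have "\<dots> = count_list \<alpha> g"
    by (simp add: count_list_eq_length_filter length_filter_conv_card eq_commute)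
  finally have "r \<le> int (count_list \<alpha> g)" using assms(7) by linarith
  moreover obtain j where "j \<in> S" using S(2) by auto
  then have "g \<in> set \<alpha>" using S(1) S_eq by (metis lessThan_iff nth_mem subsetD)
  moreover have "g \<in> zmod_generators n"
    using assms(1,3) by (simp add: zmod_generators_iff g_def)
  ultimately show ?thesis by (auto simp: generator_of_mult_ge_def)
qed

text \<open>
  Termwise, \<open>y j\<close> falls short of 2 only if it is 1, and short of 3 only by 2 for a one and by 1 for
  a two.
\<close>
lemma count_ones_twos:
  fixes y :: "'i \<Rightarrow> nat"
  assumes "finite J" "\<And>j. j \<in> J \<Longrightarrow> 1 \<le> y j"
  shows "2 * card J \<le> sum y J + card {j \<in> J. y j = 1}"
    and "3 * card J \<le> sum y J + 2 * card {j \<in> J. y j = 1} + card {j \<in> J. y j = 2}"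
proof -
  have card: "card {j \<in> J. y j = k} = (\<Sum>j\<in>J. of_bool (y j = k))" for k
    using assms(1) by (simp only: of_bool_def sum.inter_filter[symmetric] card_eq_sum)
  have le2: "2 \<le> y j + of_bool (y j = 1)"
    and le3: "3 \<le> y j + 2 * of_bool (y j = 1) + of_bool (y j = 2)" if "j \<in> J" for j
    using assms(2)[OF that] by (cases "y j = 1"; cases "y j = 2"; simp)+
  have "2 * card J = (\<Sum>j\<in>J. 2)" by simp
  also have "\<dots> \<le> (\<Sum>j\<in>J. y j + of_bool (y j = 1))"
    by (rule sum_mono) (rule le2)
  also have "\<dots> = sum y J + card {j \<in> J. y j = 1}"
    by (simp only: card sum.distrib)
  finally show "2 * card J \<le> sum y J + card {j \<in> J. y j = 1}" .
  have "3 * card J = (\<Sum>j\<in>J. 3)" by simp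
  also have "\<dots> \<le> (\<Sum>j\<in>J. y j + 2 * of_bool (y j = 1) + of_bool (y j = 2))"
    by (rule sum_mono) (rule le3)
  also have "\<dots> = sum y J + 2 * card {j \<in> J. y j = 1} + card {j \<in> J. y j = 2}"
    by (simp only: card sum.distrib sum_distrib_left)
  finally show "3 * card J \<le> sum y J + 2 * card {j \<in> J. y j = 1} + card {j \<in> J. y j = 2}" .
qed

text \<open>
  The terms \<open>b\<close> correspond to \<open>y j = 1\<close>. For odd \<open>n\<close> the terms \<open>2 * b\<close>, with \<open>y j = 2\<close>, are generators
  too; if \<open>m\<close> is the larger of the two multiplicities, then \<open>3 * l \<le> sum y + 3 * m \<le> n - 1 + 3 * m\<close>.
\<close>
lemma generator_multiplicity_lower_bounds:
  assumes "l < n" "n < 2 * l" "zero_free (integer_mod_group n) \<alpha>" "length \<alpha> = l"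
  shows "generator_of_mult_ge n \<alpha> (2 * int l - int n + 1)"
    and "odd n \<Longrightarrow> generator_of_mult_ge n \<alpha> (int l - (int n - 1) div 3)"
proof -
  have n: "0 < n" using assms by simp
  then interpret zero_free_mod "int n" "\<lambda>i. \<alpha> ! i" "{..<l}"
    using zero_free_imp_zero_free_mod assms by blast
  obtain b y where b: "coprime b (int n)"
    and y: "\<And>j. j \<in> {..<l} \<Longrightarrow> 1 \<le> y j" "\<And>j. j \<in> {..<l} \<Longrightarrow> int n dvd \<alpha> ! j - int (y j) * b"
    and total: "int (sum y {..<l}) < int n"
    using long_zero_free_structure assms(2) by auto
  define ones where "ones = {j \<in> {..<l}. y j = 1}"
  define twos where "twos = {j \<in> {..<l}. y j = 2}"
  have range: "set \<alpha> \<subseteq> {0..<int n}"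
    using assms(3) n by (simp add: zero_free_def carrier_integer_mod_group)
  have mult_ones: "generator_of_mult_ge n \<alpha> r" if "r \<le> int (card ones)" "0 < card ones" for r
  proof (rule generator_of_mult_geI[OF n range b])
    show "int n dvd \<alpha> ! j - b" if "j \<in> ones" for j
      using y(2)[of j] that by (simp add: ones_def)
    show "ones \<noteq> {}" using that by auto
  qed (use that assms(4) in \<open>auto simp: ones_def\<close>)
  have mult_twos: "generator_of_mult_ge n \<alpha> r"
    if "odd n" "r \<le> int (card twos)" "0 < card twos" for r
  proof (rule generator_of_mult_geI[OF n range])
    show "coprime (2 * b) (int n)" using b \<open>odd n\<close> by (simp add: coprime_left_2_iff_odd)
    show "int n dvd \<alpha> ! j - 2 * b" if "j \<in> twos" for j
      using y(2)[of j] that by (simp add: twos_def)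
    show "twos \<noteq> {}" using that by auto
  qed (use that assms(4) in \<open>auto simp: twos_def\<close>)
  have counts: "2 * l \<le> sum y {..<l} + card ones"
    "3 * l \<le> sum y {..<l} + 2 * card ones + card twos"
    using count_ones_twos[of "{..<l}" y] y(1) by (simp_all add: ones_def twos_def)
  have sum_lt: "sum y {..<l} < n" using total by (simp only: of_nat_less_iff)
  have "2 * int l - int n + 1 \<le> int (card ones)" "0 < card ones"
    using counts(1) sum_lt assms(2) by linarith+
  then show "generator_of_mult_ge n \<alpha> (2 * int l - int n + 1)" by (rule mult_ones)
  show "generator_of_mult_ge n \<alpha> (int l - (int n - 1) div 3)" if "odd n"
  proof (cases "card twos \<le> card ones")
    case True
    then have "3 * int l \<le> (int n - 1) + 3 * int (card ones)" using counts(2) sum_lt by linarith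
    then have "int l - (int n - 1) div 3 \<le> int (card ones)" by linarith
    then show ?thesis using mult_ones \<open>0 < card ones\<close> by blast
  next
    case False
    then have "3 * int l \<le> (int n - 1) + 3 * int (card twos)" using counts(2) sum_lt by linarith
    then have "int l - (int n - 1) div 3 \<le> int (card twos)" by linarith
    then show ?thesis using mult_twos that False by auto
  qed
qed

section \<open>Extremal sequences\<close>

lemma zero_free_positive_small_sum:
  assumes pos: "\<And>x. x \<in> set \<alpha> \<Longrightarrow> 0 < x" and small: "sum_list \<alpha> < int n"
  shows "zero_free (integer_mod_group n) \<alpha>"
proof -
  have total: "sum_list \<alpha> = (\<Sum>i<length \<alpha>. \<alpha> ! i)"
    by (simp add: sum_list_sum_nth atLeast0LessThan)
  have nth_pos: "0 < \<alpha> ! i" if "i < length \<alpha>" for i using pos that by simp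
  have part: "0 < (\<Sum>i\<in>I. \<alpha> ! i)" "(\<Sum>i\<in>I. \<alpha> ! i) < int n" if "I \<subseteq> {..<length \<alpha>}" "I \<noteq> {}" for I
  proof -
    have "finite I" using that finite_subset by blast
    then show "0 < (\<Sum>i\<in>I. \<alpha> ! i)" using that nth_pos by (intro sum_pos) auto
    have "(\<Sum>i\<in>I. \<alpha> ! i) \<le> (\<Sum>i<length \<alpha>. \<alpha> ! i)"
      using that nth_pos by (intro sum_mono2) (auto simp: less_imp_le)
    then show "(\<Sum>i\<in>I. \<alpha> ! i) < int n" using small total by simp
  qed
  have carrier: "\<alpha> ! i \<in> carrier (integer_mod_group n)" if "i < length \<alpha>" for i
    using part[of "{i}"] that by (auto simp: carrier_integer_mod_group)
  show ?thesis
    unfolding zero_free_def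
  proof (intro conjI allI impI)
    show "set \<alpha> \<subseteq> carrier (integer_mod_group n)" using carrier by (auto simp: in_set_conv_nth)
    fix I assume I: "I \<subseteq> {..<length \<alpha>} \<and> I \<noteq> {}"
    then have "finite I" using finite_subset by blast
    then have "finprod (integer_mod_group n) (\<lambda>i. \<alpha> ! i) I = (\<Sum>i\<in>I. \<alpha> ! i) mod int n"
      using I carrier by (intro finprod_integer_mod_group) auto
    also have "\<dots> = (\<Sum>i\<in>I. \<alpha> ! i)" using part[of I] I by simp
    finally show "finprod (integer_mod_group n) (\<lambda>i. \<alpha> ! i) I \<noteq> \<one>\<^bsub>integer_mod_group n\<^esub>"
      using part[of I] I by simp
  qed
qed

lemma count_list_replicate: "count_list (replicate k x) z = (if x = z then k else 0)"
  by (induction k) auto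

text \<open>
  The multiplicity of 2 matters only if 2 is a generator, that is, for odd \<open>n\<close>.
\<close>
lemma bound_attained_ones_twos_threes:
  assumes "0 < u" "u + 2 * v + 3 * w < n" "odd n \<Longrightarrow> v \<le> u" "w \<le> u"
  shows "bound_attained n (u + v + w) (int u)"
proof -
  define \<alpha> :: "int list" where "\<alpha> = replicate u 1 @ replicate v 2 @ replicate w 3"
  have "zero_free (integer_mod_group n) \<alpha>"
  proof (rule zero_free_positive_small_sum)
    show "sum_list \<alpha> < int n" using assms(2) by (simp add: \<alpha>_def sum_list_replicate)
  qed (auto simp: \<alpha>_def)
  moreover have "max_generator_mult n \<alpha> = u"
    unfolding max_generator_mult_def
  proof (rule Max_eqI)
    have gens: "g \<in> zmod_generators n \<longleftrightarrow> g \<in> {0..<int n} \<and> coprime g (int n)" for g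
      using assms(2) by (intro zmod_generators_iff) simp
    have "zmod_generators n \<subseteq> {0..<int n}" using gens by blast
    then show "finite (count_list \<alpha> ` zmod_generators n)" by (meson finite_atLeastLessThan_int finite_imageI finite_subset)
    show "m \<le> u" if m: "m \<in> count_list \<alpha> ` zmod_generators n" for m
    proof -
      obtain g where g: "m = count_list \<alpha> g" "g \<in> zmod_generators n" using m by blast
      then have "coprime g (int n)" using gens by blast
      then have "odd n" if "g = 2" using that coprime_left_2_iff_odd[of "int n"] by simp
      then show ?thesis using assms(3,4) g(1) by (auto simp: \<alpha>_def count_list_replicate)
    qed
    have "1 \<in> zmod_generators n" "count_list \<alpha> 1 = u"
      using assms(1,2) gens[of 1] by (simp_all add: \<alpha>_def count_list_replicate)
    then show "u \<in> count_list \<alpha> ` zmod_generators n" by (metis image_eqI)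
  qed
  moreover have "length \<alpha> = u + v + w" by (simp add: \<alpha>_def)
  ultimately show ?thesis unfolding bound_attained_def by blast
qed

text \<open>
  The multiplicities of 1 and 2 are chosen so that the length is \<open>l\<close> and the sum is \<open>n - 1\<close>. For odd \<open>n\<close>
  the twos do not outnumber the ones precisely when \<open>2 * n - 2 \<le> 3 * l\<close>.
\<close>
lemma bound_attained_ones_twos:
  assumes "l < n" "n < 2 * l" "odd n \<Longrightarrow> 2 * n \<le> 3 * l + 2"
  shows "bound_attained n l (2 * int l - int n + 1)"
proof -
  have "bound_attained n ((2 * l + 1 - n) + (n - 1 - l) + 0) (int (2 * l + 1 - n))"
    using assms by (intro bound_attained_ones_twos_threes) auto
  moreover have "(2 * l + 1 - n) + (n - 1 - l) + 0 = l" using assms by simp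
  moreover have "int (2 * l + 1 - n) = 2 * int l - int n + 1" using assms by simp
  ultimately show ?thesis by metis
qed

text \<open>
  With \<open>q = (n - 1) div 3\<close> the other terms number \<open>q\<close>, which may exceed the number \<open>l - q\<close> of ones. As
  many of them as needed are raised from 2 to 3, so that at most \<open>l - q\<close> twos remain.
\<close>
lemma bound_attained_with_threes:
  assumes "n < 2 * l" "3 * l + 2 \<le> 2 * n"
  shows "bound_attained n l (int l - (int n - 1) div 3)"
proof -
  define q where "q = (n - 1) div 3"
  define w where "w = 2 * q - l"
  have n: "0 < n" using assms by simp
  have q: "3 * q \<le> n - 1" by (simp add: q_def)
  have "(l - q) + 2 * (q - w) + 3 * w < n" "q - w \<le> l - q" "w \<le> l - q" "0 < l - q"
    "(l - q) + (q - w) + w = l"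
    using assms q n unfolding w_def by linarith+
  then have "bound_attained n l (int (l - q))"
    using bound_attained_ones_twos_threes[of "l - q" "q - w" w n] by simp
  moreover have "int (l - q) = int l - (int n - 1) div 3"
    using n q assms by (simp add: q_def of_nat_diff zdiv_int)
  ultimately show ?thesis by simp
qed

theorem proposition12:
  fixes n l :: nat
  assumes "real n / 2 < real l" and "l < n"
  shows
    "(even n \<longrightarrow>
       (\<forall>\<alpha>. zero_free (integer_mod_group n) \<alpha> \<and> length \<alpha> = l \<longrightarrow>
            generator_of_mult_ge n \<alpha> (2 * int l - int n + 1)) \<and>
       bound_attained n l (2 * int l - int n + 1)) \<and>
    (odd n \<and> (2 * real n - 2) / 3 \<le> real l \<longrightarrow>
       (\<forall>\<alpha>. zero_free (integer_mod_group n) \<alpha> \<and> length \<alpha> = l \<longrightarrow>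
            generator_of_mult_ge n \<alpha> (2 * int l - int n + 1)) \<and>
       bound_attained n l (2 * int l - int n + 1)) \<and>
    (odd n \<and> real l \<le> (2 * real n - 2) / 3 \<longrightarrow>
       (\<forall>\<alpha>. zero_free (integer_mod_group n) \<alpha> \<and> length \<alpha> = l \<longrightarrow>
            generator_of_mult_ge n \<alpha> (int l - \<lfloor>(real n - 1) / 3\<rfloor>)) \<and>
       bound_attained n l (int l - \<lfloor>(real n - 1) / 3\<rfloor>))"
proof -
  have long: "n < 2 * l" using assms(1) by linarith
  have floor: "\<lfloor>(real n - 1) / 3\<rfloor> = (int n - 1) div 3"
    using floor_divide_of_int_eq[of "int n - 1" 3, where 'a = real] by simp
  have "2 * n \<le> 3 * l + 2" if "(2 * real n - 2) / 3 \<le> real l"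
  proof -
    have "real (2 * n) \<le> real (3 * l + 2)" using that by (simp add: field_simps)
    then show ?thesis by (simp only: of_nat_le_iff)
  qed
  moreover have "3 * l + 2 \<le> 2 * n" if "real l \<le> (2 * real n - 2) / 3"
  proof -
    have "real (3 * l + 2) \<le> real (2 * n)" using that by (simp add: field_simps)
    then show ?thesis by (simp only: of_nat_le_iff)
  qed
  ultimately show ?thesis
    unfolding floor
    using generator_multiplicity_lower_bounds[OF assms(2) long]
      bound_attained_ones_twos[OF assms(2) long] bound_attained_with_threes[OF long]
    by blast
qed

end
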